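(* For each infinite cardinal $\kappa$ there is a completely regular (Hausdorff) widely-connected topological space of cardinality $2^\kappa$.
   Context: A connected topological space $W$ is said to be widely-connected if every non-degenerate connected subset of $W$ is dense in $W$, where non-degenerate means having more than one point. Completely regular is understood to include the Hausdorff separation axiom (i.e. the space is Tychonoff). *)

theory Defs
  imports "HOL-Analysis.Analysis"
begin

unbundle cardinal_syntax

definition widely_connected_space :: "'a topology \<Rightarrow> bool" where
  "widely_connected_space X \<longleftrightarrow>
     connected_space X \<and>
     (\<forall>S. connectedin X S \<and> (\<exists>x\<in>S. \<exists>y\<in>S. x \<noteq> y) \<longrightarrow> X closure_of S = topspace X)"

text \<open>The library's \<^const>\<open>completely_regular_space\<close> carries no separation axiom.\<close>

definition tychonoff_space :: "'a topology \<Rightarrow> bool" where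
  "tychonoff_space X \<longleftrightarrow> completely_regular_space X \<and> Hausdorff_space X"

end

theory Submission
  imports Defs
begin

text \<open>Glue three copies of an arc in zigzag fashion (\<open>Lo\<close>, \<open>Mid\<close>, \<open>Hi\<close>), and iterate this along the
  well-order \<open>\<kappa>\<close>. The result is a transfinite version of Knaster's bucket-handle continuum: a point
  is given by digits indexed by \<open>Field \<kappa>\<close> and some \<open>t \<in> [0,1]\<close>, and its coordinates are its
  positions on the zigzag arcs determined by the finite ascending lists of indices. A connected set
  that is not dense has all its digit sequences equal from some index on. On the other hand, for any
  two nonempty open sets \<open>U\<close>, \<open>V\<close>, every class of eventually equal digit sequences contains a
  point that lies in both or in neither. There are \<open>2\<^sup>\<kappa>\<close> classes and only \<open>2\<^sup>\<kappa>\<close> pairs of open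
  sets, so one can choose points from \<open>2\<^sup>\<kappa>\<close> distinct classes such that every pair \<open>(U, V)\<close> is
  served by one of them. A separation \<open>(U, V)\<close> of the space of chosen points is then impossible,
  and a connected subset that is not dense has at most one point, since its points come from one
  class.\<close>

section \<open>Cardinal bounds for lists and for open sets of real cubes\<close>

lemma card_of_Pow_ordLeq:
  assumes "|A| \<le>o |B|"
  shows "|Pow A| \<le>o |Pow B|"
proof -
  obtain f where f: "inj_on f A" "f ` A \<subseteq> B"
    using assms card_of_ordLeq[of A B] by blast
  have "inj_on ((`) f) (Pow A)"
    using f(1) by (rule inj_on_image_Pow)
  then show ?thesis
    by (rule card_of_ordLeqI) (use f(2) in blast)
qed

text \<open>Each finite power of \<open>A\<close> stays below the infinite \<open>B\<close>, and
  lists are a countable union of these powers.\<close>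

lemma card_of_lists_ordLeq_infinite:
  assumes "infinite B" and A: "|A| \<le>o |B|"
  shows "|lists A| \<le>o |B|"
proof -
  have n: "|{xs \<in> lists A. length xs = n}| \<le>o |B|" for n
  proof (induction n)
    case 0
    have "{xs \<in> lists A. length xs = 0} = {[]}" by auto
    then show ?case
      using assms by (metis card_of_singl_ordLeq finite.emptyI)
  next
    case (Suc n)
    let ?C = "{xs \<in> lists A. length xs = n}"
    have "{xs \<in> lists A. length xs = Suc n} = (\<lambda>(x, xs). x # xs) ` (A \<times> ?C)"
      by (auto simp: length_Suc_conv image_iff)
    then have "|{xs \<in> lists A. length xs = Suc n}| \<le>o |A \<times> ?C|"
      using card_of_image[of "\<lambda>(x, xs). x # xs" "A \<times> ?C"] by simp
    also have "|A \<times> ?C| \<le>o |B|"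
      using assms Suc by (intro card_of_Sigma_ordLeq_infinite ballI)
    finally show ?case .
  qed
  have eq: "lists A = (\<Union>n\<in>(UNIV::nat set). {xs \<in> lists A. length xs = n})"
    by auto
  have "|UNIV::nat set| \<le>o |B|"
    using assms(1) infinite_iff_card_of_nat by blast
  then have "|\<Union>n\<in>(UNIV::nat set). {xs \<in> lists A. length xs = n}| \<le>o |B|"
    using n by (intro card_of_UNION_ordLeq_infinite[OF assms(1)] ballI)
  then show ?thesis unfolding eq[symmetric] .
qed

text \<open>Boxes with rational bounds on finitely many coordinates form a base, coded by lists over
  \<open>K\<close>. An open set is determined by the codes of the boxes inside it.\<close>

lemma card_of_openin_product_euclideanreal:
  fixes B :: "'b set"
  assumes "infinite B" and I: "|I| \<le>o |B|"
  shows "|{U. openin (product_topology (\<lambda>_. euclideanreal) I) U}| \<le>o |Pow B|"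
proof -
  let ?P = "product_topology (\<lambda>_. euclideanreal) I"
  define K where "K = I \<times> (UNIV :: (rat \<times> rat) set)"
  define box where "box L = {x \<in> topspace ?P.
      \<forall>(i, p, q) \<in> set L. real_of_rat p < x i \<and> x i < real_of_rat q}"
    for L :: "('a \<times> rat \<times> rat) list"
  have base: "\<exists>L \<in> lists K. x \<in> box L \<and> box L \<subseteq> U" if U: "openin ?P U" "x \<in> U" for U x
  proof -
    obtain X where X: "finite {i \<in> I. X i \<noteq> UNIV}" "\<And>i. i \<in> I \<Longrightarrow> open (X i)"
      "x \<in> Pi\<^sub>E I X" "Pi\<^sub>E I X \<subseteq> U"
      using U unfolding openin_product_topology_alt by auto
    have "\<exists>p q. real_of_rat p < x i \<and> x i < real_of_rat q \<and>
        {real_of_rat p <..< real_of_rat q} \<subseteq> X i" if "i \<in> I" for i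
    proof -
      have "open (X i)" "x i \<in> X i" using X that by auto
      then obtain e where e: "e > 0" "\<And>y. \<bar>y - x i\<bar> < e \<Longrightarrow> y \<in> X i"
        unfolding open_dist dist_real_def by blast
      obtain p where p: "x i - e < real_of_rat p" "real_of_rat p < x i"
        using of_rat_dense[of "x i - e" "x i"] e by auto
      obtain q where q: "x i < real_of_rat q" "real_of_rat q < x i + e"
        using of_rat_dense[of "x i" "x i + e"] e by auto
      have "{real_of_rat p <..< real_of_rat q} \<subseteq> X i"
        using p q by (auto intro!: e(2))
      with p q show ?thesis by blast
    qed
    then obtain p q where pq: "\<And>i. i \<in> I \<Longrightarrow> real_of_rat (p i) < x i \<and> x i < real_of_rat (q i) \<and>
        {real_of_rat (p i) <..< real_of_rat (q i)} \<subseteq> X i"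
      by metis
    obtain js where js: "set js = {i \<in> I. X i \<noteq> UNIV}"
      using finite_list[OF X(1)] by blast
    define L where "L = map (\<lambda>i. (i, p i, q i)) js"
    have sL: "set L = (\<lambda>i. (i, p i, q i)) ` {i \<in> I. X i \<noteq> UNIV}"
      using js by (simp add: L_def)
    have "L \<in> lists K" using sL by (auto simp: K_def)
    moreover have "x \<in> box L"
      using sL pq U openin_subset[OF U(1)] by (auto simp: box_def)
    moreover have "box L \<subseteq> Pi\<^sub>E I X"
    proof
      fix y assume y: "y \<in> box L"
      then have "y i \<in> X i" if "i \<in> I" for i
      proof (cases "X i = UNIV")
        case False
        then have "(i, p i, q i) \<in> set L" using that sL by auto
        then have "real_of_rat (p i) < y i \<and> y i < real_of_rat (q i)"
          using y by (auto simp: box_def)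
        then show ?thesis using pq[OF that] by auto
      qed auto
      then show "y \<in> Pi\<^sub>E I X" using y by (auto simp: box_def PiE_iff)
    qed
    ultimately show ?thesis using X(4) by blast
  qed
  let ?f = "\<lambda>U. {L \<in> lists K. box L \<subseteq> U}"
  have "U = V" if "openin ?P U" "openin ?P V" "?f U = ?f V" for U V
    using base[OF that(1)] base[OF that(2)] that(3) by blast
  then have "inj_on ?f {U. openin ?P U}" by (auto intro!: inj_onI)
  then have "|{U. openin ?P U}| \<le>o |Pow (lists K)|"
    by (rule card_of_ordLeqI) auto
  also have "|Pow (lists K)| \<le>o |Pow B|"
  proof -
    have "|UNIV :: (rat \<times> rat) set| \<le>o |UNIV :: nat set|"
      by (rule card_of_ordLeqI[of to_nat]) auto
    also have "|UNIV :: nat set| \<le>o |B|"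
      using assms(1) infinite_iff_card_of_nat by blast
    finally have "|K| \<le>o |B|"
      unfolding K_def using assms by (intro card_of_Sigma_ordLeq_infinite ballI)
    then show ?thesis
      by (intro card_of_Pow_ordLeq card_of_lists_ordLeq_infinite assms(1))
  qed
  finally show ?thesis .
qed

section \<open>Transport of the Tychonoff property\<close>

text \<open>Along an injection the pullback is a copy of a subspace: separating functions are
  composed with \<open>h\<close>, disjoint open sets are pulled back.\<close>

lemma tychonoff_space_pullback:
  assumes "tychonoff_space Y" "inj_on h A" "h ` A \<subseteq> topspace Y"
  shows "tychonoff_space (pullback_topology A h Y)" (is "tychonoff_space ?X")
proof -
  have top: "topspace ?X = A"
    using assms(3) by (auto simp: topspace_pullback_topology)
  have "continuous_map ?X Y (id \<circ> h)"
    by (rule continuous_map_pullback) simp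
  then have h: "continuous_map ?X Y h" by simp
  have "\<exists>f. continuous_map ?X (top_of_set {0..1::real}) f \<and> f x = 0 \<and> f ` C \<subseteq> {1}"
    if C: "closedin ?X C" "x \<in> topspace ?X - C" for C x
  proof -
    obtain U where U: "openin Y U" "A - C = h -` U \<inter> A"
      using C(1) unfolding closedin_def top openin_pullback_topology by blast
    have "closedin Y (topspace Y - U)" using U(1) by blast
    moreover have "h x \<in> topspace Y - (topspace Y - U)"
      using C(2) U assms(3) unfolding top by blast
    ultimately obtain f where f: "continuous_map Y (top_of_set {0..1::real}) f" "f (h x) = 0"
      "f ` (topspace Y - U) \<subseteq> {1}"
      using assms(1) unfolding tychonoff_space_def completely_regular_space_def by meson
    have "h c \<in> topspace Y - U" if "c \<in> C" for c
      using that closedin_subset[OF C(1)] U(2) assms(3) unfolding top by blast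
    then have "(f \<circ> h) ` C \<subseteq> {1}" using f(3) by auto
    with f h show ?thesis by (intro exI[of _ "f \<circ> h"]) (auto intro: continuous_map_compose)
  qed
  then have "completely_regular_space ?X"
    unfolding completely_regular_space_def by blast
  moreover have "Hausdorff_space ?X"
    unfolding Hausdorff_space_def top
  proof (intro allI impI, elim conjE)
    fix x y assume xy: "x \<in> A" "y \<in> A" "x \<noteq> y"
    then have "h x \<noteq> h y" "h x \<in> topspace Y" "h y \<in> topspace Y"
      using assms(2,3) by (auto dest: inj_onD)
    then obtain U V where "openin Y U" "openin Y V" "h x \<in> U" "h y \<in> V" "disjnt U V"
      using assms(1) unfolding tychonoff_space_def Hausdorff_space_def by blast
    then show "\<exists>U V. openin ?X U \<and> openin ?X V \<and> x \<in> U \<and> y \<in> V \<and> disjnt U V"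
      using xy unfolding openin_pullback_topology
      by (intro exI[of _ "h -` U \<inter> A"] exI[of _ "h -` V \<inter> A"]) (auto simp: disjnt_def)
  qed
  ultimately show ?thesis by (simp add: tychonoff_space_def)
qed

section \<open>Zigzag arcs\<close>

datatype digit = Lo | Mid | Hi

text \<open>The middle leg runs backwards, so neighbours share an end: \<open>Lo\<close> and
  \<open>Mid\<close> meet at \<open>s = 1\<close> in the value 1/3, \<open>Mid\<close> and
  \<open>Hi\<close> at \<open>s = 0\<close> in the value 2/3.\<close>

primrec leg :: "digit \<Rightarrow> real \<Rightarrow> real" where
  "leg Lo s = s / 3"
| "leg Mid s = (2 - s) / 3"
| "leg Hi s = (2 + s) / 3"

text \<open>With the last index most significant, this is the position on the arc that results from
  repeatedly gluing three copies of the unit interval into a zigzag.\<close>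

definition zigzag :: "('a \<Rightarrow> digit) \<Rightarrow> real \<Rightarrow> 'a list \<Rightarrow> real" where
  "zigzag c t js = fold (\<lambda>j. leg (c j)) js t"

lemma zigzag_Nil [simp]: "zigzag c t [] = t"
  and zigzag_snoc [simp]: "zigzag c t (js @ [j]) = leg (c j) (zigzag c t js)"
  by (simp_all add: zigzag_def)

lemma leg_bounds: "s \<in> {0..1} \<Longrightarrow> leg d s \<in> {0..1}"
  by (cases d) auto

lemma zigzag_bounds: "t \<in> {0..1} \<Longrightarrow> zigzag c t js \<in> {0..1}"
  by (induction js rule: rev_induct) (use leg_bounds in auto)

lemma zigzag_cong: "(\<And>j. j \<in> set js \<Longrightarrow> c j = d j) \<Longrightarrow> zigzag c t js = zigzag d t js"
  by (induction js rule: rev_induct) auto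

lemma continuous_on_zigzag: "continuous_on S (\<lambda>t. zigzag c t js)"
proof (induction js rule: rev_induct)
  case (snoc j js)
  then show ?case by (cases "c j") (auto intro!: continuous_intros)
qed simp

lemma leg_interior: "0 < s \<Longrightarrow> s < 1 \<Longrightarrow> 0 < leg d s \<and> leg d s < 1"
  by (cases d) auto

text \<open>Legs overlap only in the images of endpoints, so it suffices that one of the two
  parameters is interior.\<close>

lemma leg_inject:
  assumes "leg d s = leg d' s'" and "s \<in> {0..1}" and "0 < s'" "s' < 1"
  shows "d = d'" and "s = s'"
  using assms by (cases d; cases d'; auto simp: field_simps)+

lemma zigzag_interior: "0 < t \<Longrightarrow> t < 1 \<Longrightarrow> 0 < zigzag c t js \<and> zigzag c t js < 1"
  by (induction js rule: rev_induct) (use leg_interior in auto)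

lemma zigzag_inject:
  assumes "zigzag c t js = zigzag d s js" and "t \<in> {0..1}" and "0 < s" "s < 1"
  shows "t = s \<and> (\<forall>j \<in> set js. c j = d j)"
  using assms(1)
proof (induction js rule: rev_induct)
  case (snoc j js)
  have "leg (c j) (zigzag c t js) = leg (d j) (zigzag d s js)"
    using snoc.prems by simp
  then have "c j = d j" "zigzag c t js = zigzag d s js"
    using leg_inject zigzag_bounds[OF assms(2)] zigzag_interior[OF assms(3,4)] by blast+
  with snoc.IH show ?case by auto
qed simp

section \<open>The well-ordered index set and its ascending lists\<close>

locale card_index =
  fixes \<kappa> :: "'a rel"
  assumes card_order: "Card_order \<kappa>" and infinite_index: "infinite (Field \<kappa>)"
begin

definition less (infix "\<lless>" 50) where
  "i \<lless> j \<longleftrightarrow> (i, j) \<in> \<kappa> \<and> i \<noteq> j"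

lemma well_order: "well_order_on (Field \<kappa>) \<kappa>"
  using card_order card_order_on_well_order_on by blast

lemma less_trans: "i \<lless> j \<Longrightarrow> j \<lless> k \<Longrightarrow> i \<lless> k"
  using well_order unfolding less_def order_on_defs
  by (metis antisymD transD)

lemma less_asym: "i \<lless> j \<Longrightarrow> \<not> j \<lless> i"
  using well_order unfolding less_def order_on_defs
  by (metis antisymD)

lemma less_irrefl [simp]: "\<not> i \<lless> i"
  by (simp add: less_def)

lemma less_linear: "i \<in> Field \<kappa> \<Longrightarrow> j \<in> Field \<kappa> \<Longrightarrow> i \<lless> j \<or> i = j \<or> j \<lless> i"
  using well_order unfolding less_def order_on_defs total_on_def by blast

lemma less_Field: "i \<lless> j \<Longrightarrow> i \<in> Field \<kappa>" "i \<lless> j \<Longrightarrow> j \<in> Field \<kappa>"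
  unfolding less_def by (auto simp: Field_def)

lemma wf_less: "wfP (\<lless>)"
proof -
  have "wf (\<kappa> - Id)" using well_order by (simp add: well_order_on_def)
  moreover have "{(i, j). i \<lless> j} = \<kappa> - Id" by (auto simp: less_def)
  ultimately show ?thesis by (simp add: wfp_def)
qed

lemma no_max: "i \<in> Field \<kappa> \<Longrightarrow> \<exists>j. i \<lless> j"
  using infinite_Card_order_limit[OF card_order infinite_index] by (auto simp: less_def)

lemma finite_upper_bound:
  "finite J \<Longrightarrow> J \<subseteq> Field \<kappa> \<Longrightarrow> \<exists>b\<in>Field \<kappa>. \<forall>j\<in>J. j \<lless> b"
proof (induction rule: finite_induct)
  case empty
  have "Field \<kappa> \<noteq> {}" using infinite_index by auto
  then show ?case by auto
next
  case (insert x J)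
  then obtain b where b: "b \<in> Field \<kappa>" "\<forall>j\<in>J. j \<lless> b" by auto
  obtain b' where b': "x \<lless> b'" using no_max insert.prems by blast
  have "b' \<lless> b \<or> b' = b \<or> b \<lless> b'" using b b' less_Field less_linear by blast
  with b b' show ?case by (metis insertE less_Field(2) less_trans)
qed

definition ascending :: "'a list set" where
  "ascending = {js. set js \<subseteq> Field \<kappa> \<and> sorted_wrt (\<lless>) js}"

lemma ex_ascending: "finite J \<Longrightarrow> J \<subseteq> Field \<kappa> \<Longrightarrow> \<exists>js\<in>ascending. set js = J"
proof (induction rule: finite_induct)
  case empty
  have "[] \<in> ascending" by (simp add: ascending_def)
  then show ?case by (metis empty_set)
next
  case (insert x J)
  then obtain js where js: "js \<in> ascending" "set js = J" by auto
  let ?js = "filter (\<lambda>j. j \<lless> x) js @ [x] @ filter (\<lambda>j. x \<lless> j) js"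
  have "set ?js = insert x J"
  proof -
    have "\<forall>j\<in>J. j \<lless> x \<or> x \<lless> j"
      using insert less_linear by blast
    then show ?thesis using js(2) by auto
  qed
  moreover have "?js \<in> ascending"
  proof -
    have "sorted_wrt (\<lless>) ?js"
      using js less_trans unfolding sorted_wrt_append
      by (simp add: ascending_def sorted_wrt_filter) blast
    then show ?thesis
      using js insert.prems \<open>set ?js = insert x J\<close> by (simp add: ascending_def)
  qed
  ultimately show ?case by metis
qed

lemma ascending_snoc:
  "js \<in> ascending \<Longrightarrow> \<forall>j\<in>set js. j \<lless> b \<Longrightarrow> b \<in> Field \<kappa> \<Longrightarrow> js @ [b] \<in> ascending"
  by (auto simp: ascending_def sorted_wrt_append)

lemma ascending_snocD:
  "js @ [b] \<in> ascending \<Longrightarrow> js \<in> ascending" "js @ [b] \<in> ascending \<Longrightarrow> j \<in> set js \<Longrightarrow> j \<lless> b"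
  by (auto simp: ascending_def sorted_wrt_append)

section \<open>Points of the cube and eventual equality of digits\<close>

abbreviation cube :: "('a list \<Rightarrow> real) topology" where
  "cube \<equiv> product_topology (\<lambda>_. euclideanreal) ascending"

text \<open>The coordinate at \<open>[]\<close> is the parameter itself. The map is not injective:
  ends of different arcs may coincide, and this links the arcs.\<close>

definition pt :: "('a \<Rightarrow> digit) \<times> real \<Rightarrow> 'a list \<Rightarrow> real" where
  "pt z = (\<lambda>js\<in>ascending. zigzag (fst z) (snd z) js)"

text \<open>Digits may differ on a bounded set of indices, which can be infinite when
  \<open>\<kappa>\<close> is uncountable.\<close>

definition tail_eq :: "('a \<Rightarrow> digit) \<Rightarrow> ('a \<Rightarrow> digit) \<Rightarrow> bool" (infix "\<simeq>" 50) where
  "c \<simeq> d \<longleftrightarrow> (\<exists>b\<in>Field \<kappa>. \<forall>i. b \<lless> i \<longrightarrow> c i = d i)"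

lemma pt_in_topspace: "pt z \<in> topspace cube"
  by (simp add: pt_def)

lemma continuous_map_pt: "continuous_map (top_of_set S) cube (\<lambda>t. pt (c, t))"
  unfolding continuous_map_componentwise
  by (auto simp: pt_def continuous_on_zigzag)

lemma openin_cube_finite:
  assumes "openin cube U" and "pt z \<in> U"
  obtains J where "finite J" "J \<subseteq> ascending"
    "\<And>w. (\<And>js. js \<in> J \<Longrightarrow> pt w js = pt z js) \<Longrightarrow> pt w \<in> U"
proof -
  obtain X where X: "finite {i \<in> ascending. X i \<noteq> UNIV}"
    "pt z \<in> Pi\<^sub>E ascending X" "Pi\<^sub>E ascending X \<subseteq> U"
    using assms unfolding openin_product_topology_alt by auto
  show thesis
  proof (rule that[OF X(1)])
    fix w assume w: "\<And>js. js \<in> {i \<in> ascending. X i \<noteq> UNIV} \<Longrightarrow> pt w js = pt z js"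
    have "pt w js \<in> X js" if "js \<in> ascending" for js
      using that w[of js] X(2) by (cases "X js = UNIV") auto
    then have "pt w \<in> Pi\<^sub>E ascending X"
      by (auto simp: pt_def PiE_iff)
    then show "pt w \<in> U" using X(3) by blast
  qed auto
qed

text \<open>A basic neighbourhood restricts finitely many coordinates, and these involve finitely
  many digits. The parameter stays fixed, since it enters every coordinate.\<close>

lemma openin_cube_coords:
  assumes "openin cube U" and "pt (c, t) \<in> U"
  obtains js where "js \<in> ascending"
    "\<And>d. (\<And>j. j \<in> set js \<Longrightarrow> d j = c j) \<Longrightarrow> pt (d, t) \<in> U"
proof -
  obtain J where J: "finite J" "J \<subseteq> ascending"
    "\<And>w. (\<And>js. js \<in> J \<Longrightarrow> pt w js = pt (c, t) js) \<Longrightarrow> pt w \<in> U"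
    using openin_cube_finite[OF assms] by blast
  have "finite (\<Union>(set ` J))" "\<Union>(set ` J) \<subseteq> Field \<kappa>"
    using J by (auto simp: ascending_def)
  then obtain js where js: "js \<in> ascending" "set js = \<Union>(set ` J)"
    using ex_ascending by blast
  show thesis
  proof (rule that[OF js(1)])
    fix d assume d: "\<And>j. j \<in> set js \<Longrightarrow> d j = c j"
    have "zigzag d t ks = zigzag c t ks" if "ks \<in> J" for ks
      using that d js(2) by (intro zigzag_cong) auto
    then show "pt (d, t) \<in> U"
      using J(2) by (intro J(3)) (auto simp: pt_def)
  qed
qed

text \<open>If the digits below \<open>j\<close> are all \<open>Lo\<close>, then the zigzag through indices below \<open>j\<close> stays at
  \<open>0\<close>, where \<^term>\<open>leg Mid\<close> and \<^term>\<open>leg Hi\<close> agree.\<close>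

lemma pt_Mid_Hi:
  assumes "\<And>i. i \<lless> j \<Longrightarrow> c i = Lo"
  shows "pt (c(j := Mid), 0) = pt (c(j := Hi), 0)"
proof -
  have "zigzag (c(j := Mid)) 0 js = zigzag (c(j := Hi)) 0 js \<and>
      ((\<forall>i\<in>set js. i \<lless> j) \<longrightarrow> zigzag (c(j := Hi)) 0 js = 0)" if "js \<in> ascending" for js
    using that
  proof (induction js rule: rev_induct)
    case (snoc b js)
    from ascending_snocD[OF snoc.prems] snoc.IH show ?case
      using less_asym[of j j] assms by (auto simp: fun_upd_def)
  qed simp
  then show ?thesis unfolding pt_def by auto
qed

text \<open>Mirror image: lower digits \<open>Hi\<close> keep the position at 1, where
  \<open>leg Lo\<close> and \<open>leg Mid\<close> agree.\<close>

lemma pt_Mid_Lo: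
  assumes "\<And>i. i \<lless> j \<Longrightarrow> c i = Hi"
  shows "pt (c(j := Mid), 1) = pt (c(j := Lo), 1)"
proof -
  have "zigzag (c(j := Mid)) 1 js = zigzag (c(j := Lo)) 1 js \<and>
      ((\<forall>i\<in>set js. i \<lless> j) \<longrightarrow> zigzag (c(j := Lo)) 1 js = 1)" if "js \<in> ascending" for js
    using that
  proof (induction js rule: rev_induct)
    case (snoc b js)
    from ascending_snocD[OF snoc.prems] snoc.IH show ?case
      using less_asym[of j j] assms by (auto simp: fun_upd_def)
  qed simp
  then show ?thesis unfolding pt_def by auto
qed

lemma tail_eq_refl: "c \<simeq> c"
  using finite_upper_bound[of "{}"] by (auto simp: tail_eq_def)

lemma tail_eq_initial_change:
  assumes "c \<simeq> e" "b \<in> Field \<kappa>" "\<And>i. b \<lless> i \<Longrightarrow> d i = c i"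
  shows "d \<simeq> e"
proof -
  obtain b' where b': "b' \<in> Field \<kappa>" "\<And>i. b' \<lless> i \<Longrightarrow> c i = e i"
    using assms(1) by (auto simp: tail_eq_def)
  obtain m where "m \<in> Field \<kappa>" "b \<lless> m" "b' \<lless> m"
    using finite_upper_bound[of "{b, b'}"] assms(2) b' by auto
  then show ?thesis
    using b' assms(3) less_trans unfolding tail_eq_def by metis
qed

lemma tail_eq_upd: "c \<simeq> e \<Longrightarrow> j \<in> Field \<kappa> \<Longrightarrow> c(j := x) \<simeq> e"
  by (erule tail_eq_initial_change) auto

lemma finite_change_tail_eq:
  assumes "js \<in> ascending" "\<And>i. i \<notin> set js \<Longrightarrow> d i = e i"
  shows "d \<simeq> e"
proof -
  obtain b where "b \<in> Field \<kappa>" "\<forall>j\<in>set js. j \<lless> b"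
    using finite_upper_bound[of "set js"] assms(1) by (auto simp: ascending_def)
  then show ?thesis
    using assms(2) less_asym unfolding tail_eq_def by metis
qed

section \<open>Every class meets both or neither of two open sets\<close>

text \<open>Otherwise \<open>U\<close> and \<open>V\<close> would split the class of
  \<open>e\<close> into two relatively open parts. The class is linked through glued arcs, so it
  would lie in one part, yet it is dense and meets both.\<close>

lemma ex_tail_eq_point:
  assumes U: "openin cube U" "pt (c1, t1) \<in> U" "t1 \<in> {0..1}"
    and V: "openin cube V" "pt (c2, t2) \<in> V" "t2 \<in> {0..1}"
  shows "\<exists>c t. c \<simeq> e \<and> t \<in> {0..1} \<and> (pt (c, t) \<in> U \<longleftrightarrow> pt (c, t) \<in> V)"
proof (rule ccontr)
  assume "\<not> ?thesis"
  then have xor: "pt (c, t) \<in> V \<longleftrightarrow> pt (c, t) \<notin> U" if "c \<simeq> e" "t \<in> {0..1}" for c t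
    using that by blast
  have arc: "pt (c, t) \<in> U \<longleftrightarrow> pt (c, s) \<in> U" if "c \<simeq> e" "t \<in> {0..1}" "s \<in> {0..1}" for c t s
  proof -
    have ope: "openin (top_of_set {0..1}) {x \<in> {0..1}. pt (c, x) \<in> W}" if "openin cube W" for W
      using openin_continuous_map_preimage[OF continuous_map_pt[of "{0..1}" c] that] by simp
    have "connected {0..1::real}" by simp
    from this[unfolded connected_openin]
    have "{x \<in> {0..1}. pt (c, x) \<in> U} = {} \<or> {x \<in> {0..1}. pt (c, x) \<in> V} = {}"
      using ope[OF U(1)] ope[OF V(1)] xor[OF \<open>c \<simeq> e\<close>] by blast
    then show ?thesis using that xor[OF \<open>c \<simeq> e\<close>] by blast
  qed
  \<comment> \<open>By induction on \<open>j\<close>, no digit matters: once all lower digits may be changed, resetting them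
    to \<open>Lo\<close> (to \<open>Hi\<close>) glues the arcs with \<open>j\<close>-th digit \<open>Mid\<close> and \<open>Hi\<close> (\<open>Mid\<close> and \<open>Lo\<close>).\<close>
  define G where "G = {j. \<forall>c x. c \<simeq> e \<longrightarrow> (pt (c(j := x), 0) \<in> U \<longleftrightarrow> pt (c, 0) \<in> U)}"
  have fin: "pt (c, 0) \<in> U \<longleftrightarrow> pt (d, 0) \<in> U"
    if "finite J" "J \<subseteq> G" "J \<subseteq> Field \<kappa>" "c \<simeq> e" "\<And>i. i \<notin> J \<Longrightarrow> d i = c i" for J c d
    using that
  proof (induction arbitrary: c rule: finite_induct)
    case empty
    then have "d = c" by auto
    then show ?case by simp
  next
    case (insert i J)
    have "c(i := d i) \<simeq> e"
      using insert.prems by (intro tail_eq_upd) auto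
    then have "pt (c(i := d i), 0) \<in> U \<longleftrightarrow> pt (d, 0) \<in> U"
      using insert.prems by (intro insert.IH) (auto simp: fun_upd_def)
    moreover have "pt (c(i := d i), 0) \<in> U \<longleftrightarrow> pt (c, 0) \<in> U"
      using insert.prems by (auto simp: G_def)
    ultimately show ?case by simp
  qed
  have G: "j \<in> Field \<kappa> \<longrightarrow> j \<in> G" for j
  proof (induction j rule: wfp_induct_rule[OF wf_less])
    case (1 j)
    show ?case
    proof
      assume j: "j \<in> Field \<kappa>"
      have initial: "pt (c, 0) \<in> U \<longleftrightarrow> pt (\<lambda>i. if i \<lless> j then v else c i, 0) \<in> U"
        (is "_ \<longleftrightarrow> pt (?c, 0) \<in> U") if c: "c \<simeq> e" for c v
      proof -
        have c': "?c \<simeq> e"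
          using j less_asym by (intro tail_eq_initial_change[OF c, of j]) auto
        \<comment> \<open>Infinitely many lower digits may have to be reset, but \<open>fin\<close>
          allows only finitely many changes. Inside an open \<open>W\<close> finitely many suffice;
          taking for \<open>W\<close> whichever of \<open>U\<close> and \<open>V\<close> contains
          the reset point settles its side.\<close>
        have *: "\<exists>d. pt (d, 0) \<in> W \<and> d \<simeq> e \<and> (pt (c, 0) \<in> U \<longleftrightarrow> pt (d, 0) \<in> U)"
          if W: "openin cube W" "pt (?c, 0) \<in> W" for W
        proof -
          obtain js where js: "js \<in> ascending"
            "\<And>d. (\<And>i. i \<in> set js \<Longrightarrow> d i = ?c i) \<Longrightarrow> pt (d, 0) \<in> W"
            using openin_cube_coords[OF W] by blast
          define d where "d i = (if i \<in> set js \<and> i \<lless> j then v else c i)" for i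
          have "pt (d, 0) \<in> W" by (rule js(2)) (simp add: d_def)
          moreover have "d \<simeq> e"
            using j less_asym by (intro tail_eq_initial_change[OF c, of j]) (auto simp: d_def)
          moreover have "pt (c, 0) \<in> U \<longleftrightarrow> pt (d, 0) \<in> U"
            using 1 less_Field
            by (intro fin[OF _ _ _ c, of "{i \<in> set js. i \<lless> j}"]) (auto simp: d_def)
          ultimately show ?thesis by blast
        qed
        show ?thesis
        proof (cases "pt (?c, 0) \<in> U")
          case True
          then show ?thesis using *[OF U(1) True] by blast
        next
          case False
          then have "pt (?c, 0) \<in> V" using xor[OF c', of 0] by simp
          from *[OF V(1) this] obtain d where d: "pt (d, 0) \<in> V" "d \<simeq> e"
            "pt (c, 0) \<in> U \<longleftrightarrow> pt (d, 0) \<in> U" by blast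
          with False show ?thesis using xor[of d 0] by simp
        qed
      qed
      note upd = tail_eq_upd[OF _ j]
      have I: "(\<lambda>i. if i \<lless> j then v else (c(j := x)) i)
          = (\<lambda>i. if i \<lless> j then v else c i)(j := x)" for c :: "'a \<Rightarrow> digit" and v x
        using less_asym by auto
      have Hi: "pt (c(j := Hi), 0) \<in> U \<longleftrightarrow> pt (c(j := Mid), 0) \<in> U" if "c \<simeq> e" for c
        using initial[OF upd[OF that], where v = Lo] pt_Mid_Hi[of j "\<lambda>i. if i \<lless> j then Lo else c i"]
        unfolding I by auto
      have Lo: "pt (c(j := Lo), 0) \<in> U \<longleftrightarrow> pt (c(j := Mid), 0) \<in> U" if c: "c \<simeq> e" for c
      proof -
        let ?c = "\<lambda>i. if i \<lless> j then Hi else c i"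
        have "?c \<simeq> e"
          using j less_asym by (intro tail_eq_initial_change[OF c, of j]) auto
        \<comment> \<open>\<open>Lo\<close> and \<open>Mid\<close> are glued at parameter 1, so
          membership is first carried along the arc from 0 to 1.\<close>
        then have "pt (?c(j := x), 0) \<in> U \<longleftrightarrow> pt (?c(j := x), 1) \<in> U" for x
          using upd by (intro arc) auto
        then show ?thesis
          using initial[OF upd[OF c], where v = Hi] pt_Mid_Lo[of j ?c]
          unfolding I by auto
      qed
      have "pt (c(j := x), 0) \<in> U \<longleftrightarrow> pt (c(j := Mid), 0) \<in> U" if "c \<simeq> e" for c x
        using Hi[OF that] Lo[OF that] by (cases x) auto
      then have "pt (c(j := x), 0) \<in> U \<longleftrightarrow> pt (c, 0) \<in> U" if "c \<simeq> e" for c x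
        using that by (metis fun_upd_triv)
      then show "j \<in> G" by (simp add: G_def)
    qed
  qed
  \<comment> \<open>Density of the class: the finitely many digits that matter for \<open>W\<close>
    are copied from \<open>c\<close> into \<open>e\<close>, and by \<open>G\<close> this does not
    change the side.\<close>
  have centre: "\<exists>d t. d \<simeq> e \<and> t \<in> {0..1} \<and> pt (d, t) \<in> W \<and> (pt (e, 0) \<in> U \<longleftrightarrow> pt (d, t) \<in> U)"
    if W: "openin cube W" "pt (c, t) \<in> W" "t \<in> {0..1}" for W c t
  proof -
    obtain js where js: "js \<in> ascending"
      "\<And>d. (\<And>i. i \<in> set js \<Longrightarrow> d i = c i) \<Longrightarrow> pt (d, t) \<in> W"
      using openin_cube_coords[OF W(1,2)] by blast
    define d where "d i = (if i \<in> set js then c i else e i)" for i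
    have d: "d \<simeq> e"
      by (rule finite_change_tail_eq[OF js(1)]) (simp add: d_def)
    have "pt (d, t) \<in> W" by (rule js(2)) (simp add: d_def)
    moreover have "pt (e, 0) \<in> U \<longleftrightarrow> pt (d, 0) \<in> U"
      using G js(1)
      by (intro fin[OF _ _ _ tail_eq_refl, of "set js"]) (auto simp: d_def ascending_def)
    ultimately show ?thesis using arc[OF d, of t 0] d W(3) by auto
  qed
  show False
    using centre[OF U] centre[OF V] xor by blast
qed

section \<open>Connected sets that are not dense\<close>

text \<open>A connected set whose zigzag position misses an interior value \<open>r\<close> stays on one side of \<open>r\<close>.
  Below \<open>r\<close> the position is never \<open>1\<close>, the only place where \<^term>\<open>leg Lo\<close> and \<^term>\<open>leg Mid\<close>
  meet, so whether a later digit is \<open>Lo\<close> is constant on the set. After one later digit that is not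
  \<open>Lo\<close> the position avoids both endpoints, and all further digits are constant.\<close>

lemma connected_missing_open_tail_const:
  assumes A: "A \<subseteq> UNIV \<times> {0..1}" "connectedin cube (pt ` A)"
    and U: "openin cube U" "U \<inter> pt ` A = {}" "pt (c0, t0) \<in> U" "t0 \<in> {0..1}"
  shows "\<exists>b\<in>Field \<kappa>. \<forall>z\<in>A. \<forall>w\<in>A. \<forall>i. b \<lless> i \<longrightarrow> fst z i = fst w i"
proof -
  let ?f = "\<lambda>js z. zigzag (fst z) (snd z) js"
  have split: "(\<forall>z\<in>A. ?f js z < r) \<or> (\<forall>z\<in>A. r < ?f js z)"
    if "js \<in> ascending" "\<forall>z\<in>A. ?f js z \<noteq> r" for js r
  proof -
    have "connectedin euclideanreal ((\<lambda>x. x js) ` pt ` A)"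
      using that(1) by (intro connectedin_continuous_map_image[OF _ A(2)])
        (auto intro: continuous_map_product_projection)
    moreover have "(\<lambda>x. x js) ` pt ` A = ?f js ` A"
      using that(1) by (auto simp: pt_def image_image)
    ultimately have "connected (?f js ` A)" by simp
    then show ?thesis
      using that(2) unfolding connected_iff_interval
      by (smt (verit, best) image_iff)
  qed
  have f01: "0 \<le> ?f js z" "?f js z \<le> 1" if "z \<in> A" for js z
    using zigzag_bounds[of "snd z" "fst z" js] that A(1) by auto
  \<comment> \<open>The digit \<open>b\<close> is \<open>Lo\<close> exactly when the new position is
    below 1/3, and 1/3 itself would need the excluded position 1. \<open>Hi_const\<close> is the
    mirror image at 2/3.\<close>
  have Lo_const: "(\<forall>z\<in>A. fst z b = Lo) \<or> (\<forall>z\<in>A. fst z b \<noteq> Lo)"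
    if "js @ [b] \<in> ascending" "\<forall>z\<in>A. ?f js z \<noteq> 1" for js b
  proof -
    have *: "?f (js @ [b]) z < 1 / 3 \<longleftrightarrow> fst z b = Lo" "?f (js @ [b]) z \<noteq> 1 / 3" if "z \<in> A" for z
      using f01[OF that, of js] \<open>\<forall>z\<in>A. ?f js z \<noteq> 1\<close>[rule_format, OF that]
      by (cases "fst z b"; simp add: field_simps)+
    show ?thesis using split[OF that(1), of "1/3"] * by (meson order_less_asym)
  qed
  have Hi_const: "(\<forall>z\<in>A. fst z b = Hi) \<or> (\<forall>z\<in>A. fst z b \<noteq> Hi)"
    if "js @ [b] \<in> ascending" "\<forall>z\<in>A. ?f js z \<noteq> 0" for js b
  proof -
    have *: "2 / 3 < ?f (js @ [b]) z \<longleftrightarrow> fst z b = Hi" "?f (js @ [b]) z \<noteq> 2 / 3" if "z \<in> A" for z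
      using f01[OF that, of js] \<open>\<forall>z\<in>A. ?f js z \<noteq> 0\<close>[rule_format, OF that]
      by (cases "fst z b"; simp add: field_simps)+
    show ?thesis using split[OF that(1), of "2/3"] * by (meson order_less_asym)
  qed
  have final: ?thesis
    if js: "js \<in> ascending" "\<forall>z\<in>A. ?f js z \<noteq> 0 \<and> ?f js z \<noteq> 1" for js
  proof -
    obtain b where b: "b \<in> Field \<kappa>" "\<forall>j\<in>set js. j \<lless> b"
      using finite_upper_bound[of "set js"] js by (auto simp: ascending_def)
    have "fst z i = fst w i" if "b \<lless> i" "z \<in> A" "w \<in> A" for z w i
    proof -
      have "js @ [i] \<in> ascending"
        using js b that less_trans less_Field by (blast intro: ascending_snoc)
      from Lo_const[OF this] Hi_const[OF this] js that
      have "fst z i = Lo \<longleftrightarrow> fst w i = Lo" "fst z i = Hi \<longleftrightarrow> fst w i = Hi" by blast+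
      then show ?thesis by (cases "fst z i"; cases "fst w i") auto
    qed
    with b(1) show ?thesis by blast
  qed
  \<comment> \<open>\<open>t0\<close> may be an endpoint; openness moves it to an interior
    parameter, as \<open>zigzag_inject\<close> requires.\<close>
  obtain t where t: "0 < t" "t < 1" "pt (c0, t) \<in> U"
  proof -
    have "openin (top_of_set {0..1}) {x \<in> {0..1}. pt (c0, x) \<in> U}"
      using openin_continuous_map_preimage[OF continuous_map_pt[of "{0..1}" c0] U(1)] by simp
    then obtain T where T: "open T" "{x \<in> {0..1}. pt (c0, x) \<in> U} = {0..1} \<inter> T"
      by (auto simp: openin_open)
    have "T \<inter> closure {0<..<1} \<noteq> {}" using T(2) U(3,4) by auto
    then have "T \<inter> {0<..<1} \<noteq> {}" using open_Int_closure_eq_empty[OF T(1)] by blast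
    then obtain t where "t \<in> T" "0 < t" "t < 1" by auto
    moreover from this have "t \<in> {x \<in> {0..1}. pt (c0, x) \<in> U}" unfolding T(2) by auto
    ultimately show thesis using that by blast
  qed
  obtain js where js: "js \<in> ascending"
    "\<And>d. (\<And>j. j \<in> set js \<Longrightarrow> d j = c0 j) \<Longrightarrow> pt (d, t) \<in> U"
    using openin_cube_coords[OF U(1) t(3)] by blast
  \<comment> \<open>This is the missed value: attaining it would force parameter \<open>t\<close>
    and the digits of \<open>c0\<close> on \<open>js\<close>, hence a point of
    \<open>U\<close>.\<close>
  have "?f js z \<noteq> zigzag c0 t js" if z: "z \<in> A" for z
  proof
    assume "?f js z = zigzag c0 t js"
    then have "snd z = t" "\<forall>j\<in>set js. fst z j = c0 j"
      using zigzag_inject[of "fst z" "snd z" js c0 t, OF _ _ t(1,2)] A(1) z by auto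
    then have "pt z \<in> U" using js(2)[of "fst z"] by auto
    with U(2) z show False by blast
  qed
  with split[OF js(1)]
  have "(\<forall>z\<in>A. ?f js z < zigzag c0 t js) \<or> (\<forall>z\<in>A. zigzag c0 t js < ?f js z)" by blast
  then consider (below) "\<forall>z\<in>A. ?f js z \<noteq> 1" | (above) "\<forall>z\<in>A. ?f js z \<noteq> 0"
    using zigzag_interior[OF t(1,2), of c0 js] by fastforce
  then show ?thesis
  proof cases
    case below
    show ?thesis
    proof (cases "\<exists>b. js @ [b] \<in> ascending \<and> (\<forall>z\<in>A. fst z b \<noteq> Lo)")
      case True
      then obtain b where b: "js @ [b] \<in> ascending" "\<forall>z\<in>A. fst z b \<noteq> Lo" by blast
      have "?f (js @ [b]) z \<noteq> 0 \<and> ?f (js @ [b]) z \<noteq> 1" if "z \<in> A" for z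
        using f01[OF that, of js] below b(2) that by (cases "fst z b") auto
      then show ?thesis using final[OF b(1)] by blast
    next
      \<comment> \<open>No later digit avoids \<open>Lo\<close> on all of \<open>A\<close>, so by
        \<open>Lo_const\<close> every later digit is \<open>Lo\<close> throughout.\<close>
      case False
      obtain b where b: "b \<in> Field \<kappa>" "\<forall>j\<in>set js. j \<lless> b"
        using finite_upper_bound[of "set js"] js by (auto simp: ascending_def)
      have "fst z i = Lo" if "b \<lless> i" "z \<in> A" for z i
      proof -
        have "js @ [i] \<in> ascending"
          using js b that less_trans less_Field by (blast intro: ascending_snoc)
        then show ?thesis using Lo_const[OF _ below] False that by blast
      qed
      with b(1) show ?thesis by metis
    qed
  next
    \<comment> \<open>Mirror image: with position 0 excluded, \<open>Hi\<close> takes the role of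
      \<open>Lo\<close>.\<close>
    case above
    show ?thesis
    proof (cases "\<exists>b. js @ [b] \<in> ascending \<and> (\<forall>z\<in>A. fst z b \<noteq> Hi)")
      case True
      then obtain b where b: "js @ [b] \<in> ascending" "\<forall>z\<in>A. fst z b \<noteq> Hi" by blast
      have "?f (js @ [b]) z \<noteq> 0 \<and> ?f (js @ [b]) z \<noteq> 1" if "z \<in> A" for z
        using f01[OF that, of js] above b(2) that by (cases "fst z b") auto
      then show ?thesis using final[OF b(1)] by blast
    next
      case False
      obtain b where b: "b \<in> Field \<kappa>" "\<forall>j\<in>set js. j \<lless> b"
        using finite_upper_bound[of "set js"] js by (auto simp: ascending_def)
      have "fst z i = Hi" if "b \<lless> i" "z \<in> A" for z i
      proof -
        have "js @ [i] \<in> ascending"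
          using js b that less_trans less_Field by (blast intro: ascending_snoc)
        then show ?thesis using Hi_const[OF _ above] False that by blast
      qed
      with b(1) show ?thesis by metis
    qed
  qed
qed


section \<open>Choosing points from distinct classes\<close>

lemma tail_eq_sym: "c \<simeq> d \<Longrightarrow> d \<simeq> c"
  unfolding tail_eq_def by metis

lemma tail_eq_trans:
  assumes "c \<simeq> d" "d \<simeq> e"
  shows "c \<simeq> e"
proof -
  obtain b where "b \<in> Field \<kappa>" "\<And>i. b \<lless> i \<Longrightarrow> c i = d i"
    using assms(1) by (auto simp: tail_eq_def)
  then show ?thesis by (rule tail_eq_initial_change[OF assms(2)])
qed

text \<open>A bounded image would embed \<open>Field \<kappa>\<close> into a proper initial segment,
  which is strictly smaller because \<open>\<kappa>\<close> is a cardinal.\<close>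

lemma inj_on_Field_unbounded:
  assumes "inj_on f (Field \<kappa>)" "f ` Field \<kappa> \<subseteq> Field \<kappa>" "b \<in> Field \<kappa>"
  shows "\<exists>k\<in>Field \<kappa>. b \<lless> f k"
proof (rule ccontr)
  assume neg: "\<not> ?thesis"
  obtain b' where b': "b \<lless> b'" using no_max assms(3) by blast
  have "f k \<lless> b'" if k: "k \<in> Field \<kappa>" for k
  proof -
    have "f k \<in> Field \<kappa>" "\<not> b \<lless> f k" using neg k assms(2) by auto
    then have "f k = b \<or> f k \<lless> b" using less_linear[OF assms(3)] by blast
    then show ?thesis using b' less_trans by blast
  qed
  then have "f ` Field \<kappa> \<subseteq> underS \<kappa> b'"
    by (auto simp: underS_def less_def)
  then have "|Field \<kappa>| \<le>o |underS \<kappa> b'|"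
    using assms(1) by (intro card_of_ordLeqI[of f]) auto
  moreover have "|underS \<kappa> b'| <o \<kappa>"
    using card_of_underS[OF card_order] b' less_Field by blast
  moreover have "\<kappa> =o |Field \<kappa>|"
    using card_of_Field_ordIso[OF card_order] ordIso_symmetric by blast
  ultimately have "|Field \<kappa>| <o |Field \<kappa>|"
    by (meson ordLeq_ordLess_trans ordLess_ordIso_trans)
  then show False using ordLess_irreflexive by blast
qed

text \<open>A pairing function repeats the membership bit of each index at unboundedly many places,
  so a difference between two sets survives in every tail.\<close>

lemma ex_tail_distinct_family:
  "\<exists>f :: 'a set \<Rightarrow> 'a \<Rightarrow> digit. \<forall>S\<in>Pow (Field \<kappa>). \<forall>T\<in>Pow (Field \<kappa>). f S \<simeq> f T \<longrightarrow> S = T"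
proof -
  let ?F = "Field \<kappa>"
  obtain p where p: "bij_betw p (?F \<times> ?F) ?F"
    using card_of_Times_same_infinite[OF infinite_index] card_of_ordIso by blast
  define q where "q = inv_into (?F \<times> ?F) p"
  have q: "q (p (i, k)) = (i, k)" if "i \<in> ?F" "k \<in> ?F" for i k
    unfolding q_def using that p by (intro inv_into_f_f) (auto simp: bij_betw_def)
  define f where "f S j = (if fst (q j) \<in> S then Lo else Hi)" for S j
  have "i \<in> T" if "f S \<simeq> f T" "i \<in> S" "i \<in> ?F" for S T i
  proof -
    obtain b where b: "b \<in> ?F" "\<And>j. b \<lless> j \<Longrightarrow> f S j = f T j"
      using \<open>f S \<simeq> f T\<close> by (auto simp: tail_eq_def)
    have "inj_on (\<lambda>k. p (i, k)) ?F" "(\<lambda>k. p (i, k)) ` ?F \<subseteq> ?F"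
      using p \<open>i \<in> ?F\<close> by (auto simp: bij_betw_def inj_on_def)
    then obtain k where k: "k \<in> ?F" "b \<lless> p (i, k)"
      using inj_on_Field_unbounded b(1) by blast
    from b(2)[OF k(2)] q[OF that(3) k(1)] \<open>i \<in> S\<close> show ?thesis
      by (auto simp: f_def split: if_splits)
  qed
  then have "\<forall>S\<in>Pow ?F. \<forall>T\<in>Pow ?F. f S \<simeq> f T \<longrightarrow> S = T"
    using tail_eq_sym by blast
  then show ?thesis by blast
qed

lemma card_of_openin_cube: "|{U. openin cube U}| \<le>o |Pow (Field \<kappa>)|"
proof -
  have "|ascending| \<le>o |lists (Field \<kappa>)|"
    by (rule card_of_mono1) (auto simp: ascending_def)
  also have "|lists (Field \<kappa>)| \<le>o |Field \<kappa>|"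
    using infinite_index by (intro card_of_lists_ordLeq_infinite card_of_mono1) auto
  finally show ?thesis
    by (rule card_of_openin_product_euclideanreal[OF infinite_index])
qed

text \<open>The singleton of the common point is connected and misses its open complement, so the
  previous connectedness result applies to its two representations.\<close>

lemma pt_eq_imp_tail_eq:
  assumes "pt z = pt w" "snd z \<in> {0..1}" "snd w \<in> {0..1}"
  shows "fst z \<simeq> fst w"
proof -
  have "[] \<in> ascending" by (simp add: ascending_def)
  \<comment> \<open>Parameters 0 and 1 give different points of the arc, so one of them lies in the
    complement.\<close>
  then have "pt (fst z, 0) [] \<noteq> pt (fst z, 1) []"
    by (simp add: pt_def)
  then have "pt (fst z, 0) \<noteq> pt z \<or> pt (fst z, 1) \<noteq> pt z" by metis
  then obtain t where t: "t \<in> {0..1}" "pt (fst z, t) \<noteq> pt z"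
    using that[of 0] that[of 1] by auto
  have "Hausdorff_space cube"
    by (simp add: Hausdorff_space_product_topology)
  then have "closedin cube {pt z}"
    using closedin_Hausdorff_singleton[OF _ pt_in_topspace] by blast
  then have "openin cube (topspace cube - {pt z})" by (rule openin_diff[OF openin_topspace])
  moreover have "pt ` {z, w} = {pt z}" using assms(1) by simp
  moreover have "connectedin cube {pt z}"
    using pt_in_topspace by (simp only: connectedin_sing)
  ultimately have "\<exists>b\<in>Field \<kappa>. \<forall>x\<in>{z, w}. \<forall>y\<in>{z, w}. \<forall>i. b \<lless> i \<longrightarrow> fst x i = fst y i"
    using assms t pt_in_topspace
    by (intro connected_missing_open_tail_const[of _ "topspace cube - {pt z}" "fst z" t])
       (auto simp: mem_Times_iff simp del: topspace_product_topology)
  then show ?thesis unfolding tail_eq_def by blast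
qed

text \<open>The subsets of \<open>Field \<kappa>\<close> index both distinct classes, by
  \<open>f\<close>, and all pairs of open sets, by a surjection \<open>g\<close>. The point
  \<open>z S\<close> is taken in the class of \<open>f S\<close> to serve the pair
  \<open>g S\<close>.\<close>

lemma ex_transversal:
  obtains z :: "'a set \<Rightarrow> ('a \<Rightarrow> digit) \<times> real"
  where "\<And>S. snd (z S) \<in> {0..1}"
    and "\<And>S T. S \<in> Pow (Field \<kappa>) \<Longrightarrow> T \<in> Pow (Field \<kappa>) \<Longrightarrow> fst (z S) \<simeq> fst (z T) \<Longrightarrow> S = T"
    and "\<And>U V x y. openin cube U \<Longrightarrow> openin cube V \<Longrightarrow> pt x \<in> U \<Longrightarrow> pt y \<in> V \<Longrightarrow>
      snd x \<in> {0..1} \<Longrightarrow> snd y \<in> {0..1} \<Longrightarrow>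
      \<exists>S\<in>Pow (Field \<kappa>). pt (z S) \<in> U \<longleftrightarrow> pt (z S) \<in> V"
proof -
  let ?O = "{U. openin cube U}"
  obtain f :: "'a set \<Rightarrow> 'a \<Rightarrow> digit" where
    f: "\<And>S T. S \<in> Pow (Field \<kappa>) \<Longrightarrow> T \<in> Pow (Field \<kappa>) \<Longrightarrow> f S \<simeq> f T \<Longrightarrow> S = T"
    using ex_tail_distinct_family by metis
  have "|?O \<times> ?O| \<le>o |Pow (Field \<kappa>)|"
    using infinite_index card_of_openin_cube
    by (intro card_of_Sigma_ordLeq_infinite ballI) (auto simp: finite_Pow_iff)
  moreover have "?O \<times> ?O \<noteq> {}" by blast
  ultimately obtain g where g: "g ` Pow (Field \<kappa>) = ?O \<times> ?O"
    using card_of_ordLeq2 by metis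
  define meets where "meets U \<longleftrightarrow> (\<exists>x. pt x \<in> U \<and> snd x \<in> {0..1})" for U
  have "\<exists>z. fst z \<simeq> f S \<and> snd z \<in> {0..1} \<and>
      (\<forall>U V. g S = (U, V) \<longrightarrow> openin cube U \<longrightarrow> openin cube V \<longrightarrow> meets U \<longrightarrow> meets V \<longrightarrow>
        (pt z \<in> U \<longleftrightarrow> pt z \<in> V))" for S
  proof -
    obtain U V where UV: "g S = (U, V)" by fastforce
    show ?thesis
    proof (cases "openin cube U \<and> openin cube V \<and> meets U \<and> meets V")
      case True
      then obtain x y where "pt (fst x, snd x) \<in> U" "snd x \<in> {0..1}"
        "pt (fst y, snd y) \<in> V" "snd y \<in> {0..1}"
        by (auto simp: meets_def)
      then obtain c t where "c \<simeq> f S" "t \<in> {0..1}" "pt (c, t) \<in> U \<longleftrightarrow> pt (c, t) \<in> V"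
        using ex_tail_eq_point[of U "fst x" "snd x" V "fst y" "snd y" "f S"] True by blast
      with UV show ?thesis by (intro exI[of _ "(c, t)"]) auto
    next
      \<comment> \<open>Such a pair imposes no condition, so any point of the class will do.\<close>
      case False
      with UV show ?thesis by (intro exI[of _ "(f S, 0)"]) (auto simp: tail_eq_refl)
    qed
  qed
  then obtain z where z: "\<And>S. fst (z S) \<simeq> f S" "\<And>S. snd (z S) \<in> {0..1}"
    "\<And>S U V. g S = (U, V) \<Longrightarrow> openin cube U \<Longrightarrow> openin cube V \<Longrightarrow> meets U \<Longrightarrow> meets V \<Longrightarrow>
        pt (z S) \<in> U \<longleftrightarrow> pt (z S) \<in> V"
    by metis
  show thesis
  proof (rule that[of z])
    fix S T assume "S \<in> Pow (Field \<kappa>)" "T \<in> Pow (Field \<kappa>)" "fst (z S) \<simeq> fst (z T)"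
    then show "S = T" using f z(1) tail_eq_sym tail_eq_trans by meson
  next
    fix U V x y assume UV: "openin cube U" "openin cube V" "pt x \<in> U" "pt y \<in> V"
      "snd x \<in> {0..1}" "snd y \<in> {0..1}"
    then have "(U, V) \<in> g ` Pow (Field \<kappa>)" unfolding g by blast
    then obtain S where "S \<in> Pow (Field \<kappa>)" "g S = (U, V)" by auto
    then show "\<exists>S\<in>Pow (Field \<kappa>). pt (z S) \<in> U \<longleftrightarrow> pt (z S) \<in> V"
      using z(3)[of S U V] UV unfolding meets_def by blast
  qed (rule z(2))
qed

lemma tychonoff_cube: "tychonoff_space cube"
  by (simp add: tychonoff_space_def Hausdorff_space_product_topology
      completely_regular_space_product_topology metrizable_imp_completely_regular_space
      metrizable_space_euclidean)

end

section \<open>The widely-connected space\<close>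

theorem mainTheorem1:
  fixes \<kappa> :: "'a rel"
  assumes "Card_order \<kappa>" and "cinfinite \<kappa>"
  shows "\<exists>X :: 'a set topology.
           tychonoff_space X \<and> widely_connected_space X \<and> |topspace X| =o ctwo ^c \<kappa>"
proof -
  interpret card_index \<kappa>
    using assms by unfold_locales (auto simp: cinfinite_def)
  let ?F = "Field \<kappa>"
  obtain z :: "'a set \<Rightarrow> ('a \<Rightarrow> digit) \<times> real" where
    z01: "\<And>S. snd (z S) \<in> {0..1}" and
    distinct: "\<And>S T. S \<in> Pow ?F \<Longrightarrow> T \<in> Pow ?F \<Longrightarrow> fst (z S) \<simeq> fst (z T) \<Longrightarrow> S = T" and
    hit: "\<And>U V x y. openin cube U \<Longrightarrow> openin cube V \<Longrightarrow> pt x \<in> U \<Longrightarrow> pt y \<in> V \<Longrightarrow>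
      snd x \<in> {0..1} \<Longrightarrow> snd y \<in> {0..1} \<Longrightarrow> \<exists>S\<in>Pow ?F. pt (z S) \<in> U \<longleftrightarrow> pt (z S) \<in> V"
    using ex_transversal by blast
  define h where "h S = pt (z S)" for S
  \<comment> \<open>The subsets of \<open>Field \<kappa>\<close> themselves serve as points, with
    the topology of the chosen points in the cube; this fixes the type and the cardinality.\<close>
  define X where "X = pullback_topology (Pow ?F) h cube"
  have inj: "inj_on h (Pow ?F)"
    using distinct pt_eq_imp_tail_eq[OF _ z01 z01] unfolding h_def inj_on_def by blast
  have h_top: "h S \<in> topspace cube" for S
    unfolding h_def by (rule pt_in_topspace)
  have top: "topspace X = Pow ?F"
    using h_top unfolding X_def topspace_pullback_topology by blast
  have openX: "openin X W \<longleftrightarrow> (\<exists>U. openin cube U \<and> W = h -` U \<inter> Pow ?F)" for W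
    unfolding X_def by (rule openin_pullback_topology)
  have tych: "tychonoff_space X"
    unfolding X_def using h_top
    by (intro tychonoff_space_pullback tychonoff_cube inj) blast
  have conn: "connected_space X"
    unfolding connected_space_def
  proof (intro notI, elim exE conjE)
    fix E1 E2 assume E: "openin X E1" "openin X E2" "topspace X \<subseteq> E1 \<union> E2" "E1 \<inter> E2 = {}"
      "E1 \<noteq> {}" "E2 \<noteq> {}"
    obtain U where U: "openin cube U" "E1 = h -` U \<inter> Pow ?F" using E(1) unfolding openX by blast
    obtain V where V: "openin cube V" "E2 = h -` V \<inter> Pow ?F" using E(2) unfolding openX by blast
    obtain S T where "h S \<in> U" "h T \<in> V" using E(5,6) U V by blast
    \<comment> \<open>Lying in both sets contradicts disjointness, lying in neither contradicts
      covering.\<close>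
    then obtain R where "R \<in> Pow ?F" "h R \<in> U \<longleftrightarrow> h R \<in> V"
      using hit[OF U(1) V(1) _ _ z01 z01] unfolding h_def by blast
    then show False using E(3,4) U(2) V(2) unfolding top by blast
  qed
  have wide: "X closure_of A = topspace X"
    if A: "connectedin X A" "S \<in> A" "T \<in> A" "S \<noteq> T" for A S T
  proof (rule ccontr)
    assume "X closure_of A \<noteq> topspace X"
    then obtain R where R: "R \<in> topspace X" "R \<notin> X closure_of A"
      using closure_of_subset_topspace[of X A] by blast
    then obtain W where "openin X W" "R \<in> W" "A \<inter> W = {}"
      unfolding in_closure_of by blast
    then obtain U where U: "openin cube U" "h R \<in> U" "A \<inter> (h -` U \<inter> Pow ?F) = {}"
      unfolding openX by blast
    have AF: "A \<subseteq> Pow ?F" using connectedin_subset_topspace[OF A(1)] unfolding top .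
    have "continuous_map X cube (id \<circ> h)"
      unfolding X_def by (rule continuous_map_pullback) simp
    then have "connectedin cube (h ` A)"
      using connectedin_continuous_map_image A(1) by (metis id_comp)
    then have "connectedin cube (pt ` z ` A)"
      by (simp add: h_def image_image)
    moreover have "U \<inter> pt ` z ` A = {}"
    proof -
      have "U \<inter> h ` A = {}" using U(3) AF by blast
      then show ?thesis by (simp add: h_def image_image)
    qed
    moreover have "z ` A \<subseteq> UNIV \<times> {0..1}"
      using z01 by (metis UNIV_I image_subsetI mem_Times_iff)
    \<comment> \<open>The point outside the closure shows that the missed open set \<open>U\<close>
      meets the arcs.\<close>
    moreover have "pt (fst (z R), snd (z R)) \<in> U" using U(2) by (simp add: h_def)
    ultimately have "\<exists>b\<in>?F. \<forall>x\<in>z ` A. \<forall>y\<in>z ` A. \<forall>i. b \<lless> i \<longrightarrow> fst x i = fst y i"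
      by (intro connected_missing_open_tail_const[OF _ _ U(1) _ _ z01])
    then have "fst (z S) \<simeq> fst (z T)"
      using A(2,3) unfolding tail_eq_def by fast
    then have "S = T" using A(2,3) AF by (intro distinct) auto
    with A(4) show False ..
  qed
  have "|topspace X| =o ctwo ^c \<kappa>"
    unfolding top ctwo_def cexp_def Field_card_of by (rule card_of_Pow_Func)
  with tych conn wide show ?thesis
    unfolding widely_connected_space_def by blast
qed

end
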